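(* Let $\mathcal H$ be a real Hilbert space. Suppose that $T_1,T_2:\mathcal H\to\mathcal H$ are firmly nonexpansive and $C:\mathcal H\to\mathcal H$ is $\beta$-cocoercive, $\beta>0$. Let $\gamma\in(0,2\beta)$. Then $$T:=I_{\mathcal H}-T_2+T_1\circ(2T_2-I_{\mathcal H}-\gamma C\circ T_2)$$ is $\alpha$-averaged with coefficient $\alpha:=\frac{2\beta}{4\beta-\gamma}<1$. In particular, for all $z,w\in\mathcal H$, $$\|Tz-Tw\|^2\le\|z-w\|^2-\frac{1-\alpha}{\alpha}\|(I_{\mathcal H}-T)z-(I_{\mathcal H}-T)w\|^2.$$
   Context: $C$ is $\beta$-cocoercive if $\langle Cx-Cy,x-y\rangle\ge\beta\|Cx-Cy\|^2$ for all $x,y$. A map $N:\mathcal H\to\mathcal H$ is $\lambda$-averaged ($\lambda\in(0,1)$) if $N=(1-\lambda)I_{\mathcal H}+\lambda R$ for some nonexpansive ($1$-Lipschitz) map $R$; firmly nonexpansive means $(1/2)$-averaged. *)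

theory Defs
  imports "HOL-Analysis.Analysis"
begin

definition cocoercive :: "real \<Rightarrow> ('a::real_inner \<Rightarrow> 'a) \<Rightarrow> bool" where
  "cocoercive \<beta> C \<longleftrightarrow>
     (\<forall>x y. (C x - C y) \<bullet> (x - y) \<ge> \<beta> * (norm (C x - C y))\<^sup>2)"

definition averaged :: "real \<Rightarrow> ('a::real_normed_vector \<Rightarrow> 'a) \<Rightarrow> bool" where
  "averaged l N \<longleftrightarrow>
     l \<in> {0<..<1} \<and>
     (\<exists>R. 1-lipschitz_on UNIV R \<and> N = (\<lambda>x. (1 - l) *\<^sub>R x + l *\<^sub>R R x))"

definition firmly_nonexpansive :: "('a::real_normed_vector \<Rightarrow> 'a) \<Rightarrow> bool" where
  "firmly_nonexpansive N \<longleftrightarrow> averaged (1 / 2) N"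

end

theory Submission
  imports Defs
begin

text \<open>
  An operator N is \<open>\<alpha>\<close>-averaged iff it satisfies the displayed quadratic inequality, so only the
  latter has to be checked. Between two points, let d, a, b, c be the
  increments of I, T2, \<open>T1 \<circ> (2 T2 - I - \<gamma> C \<circ> T2)\<close> and \<open>C \<circ> T2\<close>; then T has increment
  d - (a - b). Firm nonexpansiveness of T1 and T2 gives
  \<open>d \<bullet> (a - b) \<ge> \<parallel>a - b\<parallel>\<^sup>2 + \<gamma> c \<bullet> b\<close>, and splitting b = a - (a - b), cocoercivity and Young's
  inequality give \<open>c \<bullet> b \<ge> \<beta> \<parallel>c\<parallel>\<^sup>2 - c \<bullet> (a - b) \<ge> - \<parallel>a - b\<parallel>\<^sup>2 / (4 \<beta>)\<close>.
\<close>

text \<open>For increments \<open>d\<close> of I and \<open>n\<close> of an operator (1 - l) I + l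
  R, the vector on the left is l times the increment of R. Square both sides, replace 2 n \<bullet>
  d by the squared norms of \<open>n\<close>, \<open>d\<close> and \<open>d - n\<close>, and cancel
  one factor l.\<close>

lemma norm_relaxation_le_iff:
  fixes d n :: "'a::real_inner"
  assumes "l > 0"
  shows "norm (n - (1 - l) *\<^sub>R d) \<le> l * norm d \<longleftrightarrow>
    (norm n)\<^sup>2 \<le> (norm d)\<^sup>2 - (1 - l) / l * (norm (d - n))\<^sup>2"
proof -
  have "norm (n - (1 - l) *\<^sub>R d) \<le> l * norm d \<longleftrightarrow>
      (norm (n - (1 - l) *\<^sub>R d))\<^sup>2 \<le> (l * norm d)\<^sup>2"
    using assms by (auto intro: power_mono power2_le_imp_le)
  also have "\<dots> \<longleftrightarrow> l * (norm n)\<^sup>2 \<le> l * (norm d)\<^sup>2 - (1 - l) * (norm (d - n))\<^sup>2"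
    by (simp add: power_mult_distrib power2_norm_eq_inner inner_diff inner_commute)
       (simp add: algebra_simps power2_eq_square)
  also have "\<dots> \<longleftrightarrow> (norm n)\<^sup>2 \<le> (norm d)\<^sup>2 - (1 - l) / l * (norm (d - n))\<^sup>2"
    using assms by (simp add: field_simps)
  finally show ?thesis .
qed

lemma averaged_iff:
  fixes N :: "'a::real_inner \<Rightarrow> 'a"
  shows "averaged l N \<longleftrightarrow> l \<in> {0<..<1} \<and>
    (\<forall>x y. (norm (N x - N y))\<^sup>2 \<le>
      (norm (x - y))\<^sup>2 - (1 - l) / l * (norm ((x - N x) - (y - N y)))\<^sup>2)"
proof (cases "l \<in> {0<..<1}")
  case True
  then have l: "l > 0" by simp
  define R where "R = (\<lambda>x. (1 / l) *\<^sub>R (N x - (1 - l) *\<^sub>R x))"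
  \<comment> \<open>As l is nonzero, the equation can be solved for the nonexpansive part, so the
    existential in \<open>averaged\<close> reduces to a condition on this one
    \<open>R\<close>.\<close>
  have R_unique: "N = (\<lambda>x. (1 - l) *\<^sub>R x + l *\<^sub>R S x) \<longleftrightarrow> S = R" for S
    using l by (auto simp: R_def fun_eq_iff)
  have "averaged l N \<longleftrightarrow> 1-lipschitz_on UNIV R"
    using True unfolding averaged_def R_unique by auto
  also have "\<dots> \<longleftrightarrow> (\<forall>x y. norm (R x - R y) \<le> norm (x - y))"
    by (simp add: lipschitz_on_def dist_norm)
  also have "\<dots> \<longleftrightarrow> (\<forall>x y. (norm (N x - N y))\<^sup>2 \<le>
      (norm (x - y))\<^sup>2 - (1 - l) / l * (norm ((x - N x) - (y - N y)))\<^sup>2)"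
  proof (intro all_cong1)
    fix x y
    have "R x - R y = (1 / l) *\<^sub>R ((N x - N y) - (1 - l) *\<^sub>R (x - y))"
      by (simp add: R_def algebra_simps)
    then have "norm (R x - R y) \<le> norm (x - y) \<longleftrightarrow>
        norm ((N x - N y) - (1 - l) *\<^sub>R (x - y)) \<le> l * norm (x - y)"
      using l by (simp only: norm_scaleR) (simp add: pos_divide_le_eq mult.commute)
    also have "\<dots> \<longleftrightarrow> (norm (N x - N y))\<^sup>2 \<le>
        (norm (x - y))\<^sup>2 - (1 - l) / l * (norm ((x - y) - (N x - N y)))\<^sup>2"
      by (rule norm_relaxation_le_iff[OF l])
    also have "(x - y) - (N x - N y) = (x - N x) - (y - N y)"
      by simp
    finally show "norm (R x - R y) \<le> norm (x - y) \<longleftrightarrow> (norm (N x - N y))\<^sup>2 \<le>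
        (norm (x - y))\<^sup>2 - (1 - l) / l * (norm ((x - N x) - (y - N y)))\<^sup>2" .
  qed
  finally show ?thesis using True by simp
qed (auto simp: averaged_def)

text \<open>For l = 1/2 the factor (1 - l) / l is 1; expanding the squared norm of the difference
  cancels that of x - y.\<close>

lemma firmly_nonexpansive_inner:
  fixes N :: "'a::real_inner \<Rightarrow> 'a"
  assumes "firmly_nonexpansive N"
  shows "(N x - N y) \<bullet> (N x - N y) \<le> (N x - N y) \<bullet> (x - y)"
proof -
  have "(norm (N x - N y))\<^sup>2 \<le> (norm (x - y))\<^sup>2 - (norm ((x - N x) - (y - N y)))\<^sup>2"
    using assms by (simp add: firmly_nonexpansive_def averaged_iff)
  also have "(x - N x) - (y - N y) = (x - y) - (N x - N y)"
    by simp
  finally show ?thesis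
    by (simp add: power2_norm_eq_inner inner_diff inner_commute)
qed

lemma inner_ge_young:
  fixes a c e :: "'a::real_inner"
  assumes "\<beta> > 0" and "\<beta> * (norm c)\<^sup>2 \<le> c \<bullet> a"
  shows "c \<bullet> (a - e) \<ge> - (norm e)\<^sup>2 / (4 * \<beta>)"
proof -
  \<comment> \<open>The weight 2 \<beta> makes the coefficient of the squared norm of
    \<open>c\<close> exactly \<beta>, the amount that cocoercivity supplies.\<close>
  have "0 \<le> (norm ((2 * \<beta>) *\<^sub>R c - e))\<^sup>2 / (4 * \<beta>)"
    using assms(1) by simp
  also have "\<dots> = \<beta> * (norm c)\<^sup>2 - c \<bullet> e + (norm e)\<^sup>2 / (4 * \<beta>)"
    using assms(1)
    by (simp add: power2_norm_eq_inner inner_diff inner_commute field_simps)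
  finally show ?thesis
    using assms(2) by (simp add: inner_diff_right)
qed

lemma three_operator_inequality:
  fixes a b c d :: "'a::real_inner"
  assumes "\<beta> > 0" and "\<gamma> \<ge> 0"
    and a: "a \<bullet> a \<le> a \<bullet> d"
    and b: "b \<bullet> b \<le> b \<bullet> (2 *\<^sub>R a - d - \<gamma> *\<^sub>R c)"
    and c: "\<beta> * (norm c)\<^sup>2 \<le> c \<bullet> a"
  shows "(norm (d - a + b))\<^sup>2 \<le> (norm d)\<^sup>2 - (1 - \<gamma> / (2 * \<beta>)) * (norm (a - b))\<^sup>2"
proof -
  have "- (norm (a - b))\<^sup>2 / (4 * \<beta>) \<le> c \<bullet> b"
    using inner_ge_young[OF assms(1) c, of "a - b"] by simp
  then have "\<gamma> * (- (norm (a - b))\<^sup>2 / (4 * \<beta>)) \<le> \<gamma> * (c \<bullet> b)"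
    using assms(2) by (rule mult_left_mono)
  \<comment> \<open>Sum of \<open>a\<close> and \<open>b\<close>: the term 2 b \<bullet> a completes
    the square of \<open>a - b\<close>.\<close>
  moreover have "d \<bullet> (a - b) \<ge> (norm (a - b))\<^sup>2 + \<gamma> * (c \<bullet> b)"
    using a b by (simp add: power2_norm_eq_inner inner_diff inner_commute)
  \<comment> \<open>The factor 2 here doubles the Young loss \<gamma> / (4 \<beta>) to \<gamma> / (2
    \<beta>).\<close>
  moreover have "(norm (d - a + b))\<^sup>2 = (norm d)\<^sup>2 - 2 * (d \<bullet> (a - b)) + (norm (a - b))\<^sup>2"
    by (simp add: power2_norm_eq_inner inner_diff inner_add inner_commute)
  ultimately show ?thesis
    by (simp add: algebra_simps)
qed

theorem proposition3p1:
  fixes T1 T2 C T :: "'a::{real_inner, complete_space} \<Rightarrow> 'a"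
    and \<alpha> \<beta> \<gamma> :: real
  assumes "firmly_nonexpansive T1"
    and "firmly_nonexpansive T2"
    and "\<beta> > 0"
    and "cocoercive \<beta> C"
    and "\<gamma> \<in> {0<..<2 * \<beta>}"
    and T: "T = (\<lambda>z. z - T2 z + T1 (2 *\<^sub>R T2 z - z - \<gamma> *\<^sub>R C (T2 z)))"
    and \<alpha>: "\<alpha> = 2 * \<beta> / (4 * \<beta> - \<gamma>)"
  shows "\<alpha> < 1 \<and> averaged \<alpha> T \<and>
    (\<forall>z w. (norm (T z - T w))\<^sup>2 \<le>
       (norm (z - w))\<^sup>2 - (1 - \<alpha>) / \<alpha> * (norm ((z - T z) - (w - T w)))\<^sup>2)"
proof -
  have \<alpha>_bounds: "\<alpha> \<in> {0<..<1}"
    using assms(3,5) by (simp add: \<alpha> field_simps)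
  \<comment> \<open>The value of \<alpha> is the solution of this equation, which matches the
    averagedness inequality with the bound of \<open>three_operator_inequality\<close>.\<close>
  have \<alpha>_ratio: "(1 - \<alpha>) / \<alpha> = 1 - \<gamma> / (2 * \<beta>)"
    using assms(3,5) by (simp add: \<alpha> field_simps)
  have ineq: "(norm (T z - T w))\<^sup>2 \<le>
      (norm (z - w))\<^sup>2 - (1 - \<alpha>) / \<alpha> * (norm ((z - T z) - (w - T w)))\<^sup>2" for z w
  proof -
    define y where "y = (\<lambda>z. 2 *\<^sub>R T2 z - z - \<gamma> *\<^sub>R C (T2 z))"
    define a where "a = T2 z - T2 w"
    define b where "b = T1 (y z) - T1 (y w)"
    define c where "c = C (T2 z) - C (T2 w)"
    have "y z - y w = 2 *\<^sub>R a - (z - w) - \<gamma> *\<^sub>R c"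
      by (simp add: y_def a_def c_def algebra_simps)
    then have "b \<bullet> b \<le> b \<bullet> (2 *\<^sub>R a - (z - w) - \<gamma> *\<^sub>R c)"
      using firmly_nonexpansive_inner[OF assms(1), of "y z" "y w"] by (simp add: b_def)
    moreover have "a \<bullet> a \<le> a \<bullet> (z - w)"
      unfolding a_def by (rule firmly_nonexpansive_inner[OF assms(2)])
    moreover have "\<beta> * (norm c)\<^sup>2 \<le> c \<bullet> a"
      using assms(4) by (simp add: cocoercive_def a_def c_def)
    ultimately have "(norm (z - w - a + b))\<^sup>2 \<le>
        (norm (z - w))\<^sup>2 - (1 - \<gamma> / (2 * \<beta>)) * (norm (a - b))\<^sup>2"
      using assms(3,5) by (intro three_operator_inequality) auto
    moreover have "T z - T w = z - w - a + b" and "(z - T z) - (w - T w) = a - b"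
      by (simp_all add: T y_def a_def b_def)
    ultimately show ?thesis
      by (simp only: \<alpha>_ratio)
  qed
  show ?thesis
    using \<alpha>_bounds ineq by (simp add: averaged_iff)
qed

end
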